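(* Let $D>0$, let $F\in C^2(\mathbb{R})$ and $\gamma_*>0$ satisfy assumption (B) and let $\Gamma$ satisfy assumption (K) of the context. Let $\gamma\in[0,\gamma_*]$ and assume that $F_\gamma(u)=F(u)+\gamma u$ satisfies, with constants $\Phi_*,\Phi^*\in\mathbb{R}$, $$F_\gamma(u)\ge-\Phi_*\ \text{ for } u\in[u_-^\gamma,u_m^\gamma],\qquad F_\gamma(u)\le\Phi^*\ \text{ for } u\in[u_m^\gamma,u_+^\gamma],$$ and that there exist $a_*,b_*\in[u_m^\gamma,u_+^\gamma]$ with $a_*<b_*$ and $\alpha_*>0$ such that $F_\gamma(u)\ge\alpha_*(u-a_* )$ for $u\in[a_*,b_*]$, and $a^*,b^*\in[u_-^\gamma,u_m^\gamma]$ with $b^*<a^*$ and $\alpha^*>0$ such that $F_\gamma(u)\le\alpha^*(u-a^* )$ for $u\in[b^*,a^*]$. Put $$\mathcal{F}(\gamma):=\int_{u_-^\gamma}^{u_+^\gamma}F_\gamma(u)\,du .$$ Then the speed $c_\gamma$ of the traveling front of the memory equation $$\dot u(t,x)=D\,u_{xx}(t,x)+F(u(t,x))+\gamma\int_0^\infty\Gamma(\tau)\,u(t-\tau,x)\,d\tau$$ satisfies $$\mathcal F(\gamma)\le0\ \Longrightarrow\ 0\le c_\gamma\le C(\gamma,0)\le\Big(\frac{\Phi_*D}{u_+^\gamma-u_m^\gamma}\Big)^{1/2},$$ $$\mathcal F(\gamma)\ge0\ \Longrightarrow\ 0\ge c_\gamma\ge C(\gamma,0)\ge-\Big(\frac{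\Phi^*D}{u_m^\gamma-u_-^\gamma}\Big)^{1/2}.$$
   Context: For $\gamma\in\mathbb{R}$ put $F_\gamma(u):=F(u)+\gamma u$. (B): $F\in C^2(\mathbb{R})$ and $\gamma_*>0$ are such that for all $\gamma\in[0,\gamma_*]$ the function $F_\gamma$ has exactly three zeros $u_-^\gamma<u_m^\gamma<u_+^\gamma$, and $F_\gamma'(u_-^\gamma)<0$, $F_\gamma'(u_m^\gamma)>0$, $F_\gamma'(u_+^\gamma)<0$. (K): $\Gamma\in C^0([0,\infty))$, $\Gamma(\tau)\ge0$ for all $\tau\ge0$, $\int_0^\infty\Gamma(\tau)\,d\tau=1$, and $\hat g_1:=\int_0^\infty\tau\,\Gamma(\tau)\,d\tau<\infty$. Wave-speed function: for $\gamma\in[0,\gamma_*]$ and $v\in\mathbb{R}$ consider the auxiliary equation $$\dot u(t,x)=D\,u_{xx}(t,x)+F(u(t,x))+\gamma\int_0^\infty\Gamma(\tau)\,u(t,x+v\tau)\,d\tau .$$ Under (B) and (K) it has a traveling front $u(t,x)=U_{\gamma,v}(x-ct)$ with $U_{\gamma,v}(\xi)\to u_\pm^\gamma$ for $\xi\to\pm\infty$; its speed $c$ is unique and its profile is unique up to translation. One sets $C(\gamma,v):=c$. The speed $c_\gamma$ is the unique solution of $c=C(\gamma,c)$; equivalently, it is the speed of the unique (up to translation) traveling front $u(t,x)=\overline U_\gamma(x-c_\gamma t)$ of the memory equation with $\overline U_\gamma(\xi)\to u_\pm^\gamma$ for $\xi\to\pm\infty$. *)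

theory Defs
  imports "HOL-Analysis.Analysis"
begin

definition C2 :: "(real \<Rightarrow> real) \<Rightarrow> bool" where
  "C2 f \<longleftrightarrow> (\<exists>f' f''. (\<forall>x. (f has_real_derivative f' x) (at x)) \<and>
     (\<forall>x. (f' has_real_derivative f'' x) (at x)) \<and> continuous_on UNIV f'')"

definition F_gam :: "(real \<Rightarrow> real) \<Rightarrow> real \<Rightarrow> real \<Rightarrow> real" where
  "F_gam F \<gamma> u = F u + \<gamma> * u"

text \<open>The zeros are carried along as functions \<open>um\<close>, \<open>u0\<close>, \<open>up\<close> of the parameter \<open>\<gamma>\<close>;
  the set equation determines them uniquely on \<open>{0..\<gamma>s}\<close>.\<close>

definition assumption_B ::
  "(real \<Rightarrow> real) \<Rightarrow> real \<Rightarrow> (real \<Rightarrow> real) \<Rightarrow> (real \<Rightarrow> real) \<Rightarrow> (real \<Rightarrow> real) \<Rightarrow> bool" where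
  "assumption_B F \<gamma>s um u0 up \<longleftrightarrow> C2 F \<and> 0 < \<gamma>s \<and>
     (\<forall>\<gamma>\<in>{0..\<gamma>s}. {u. F_gam F \<gamma> u = 0} = {um \<gamma>, u0 \<gamma>, up \<gamma>} \<and>
        um \<gamma> < u0 \<gamma> \<and> u0 \<gamma> < up \<gamma> \<and>
        deriv (F_gam F \<gamma>) (um \<gamma>) < 0 \<and>
        deriv (F_gam F \<gamma>) (u0 \<gamma>) > 0 \<and>
        deriv (F_gam F \<gamma>) (up \<gamma>) < 0)"

definition assumption_K :: "(real \<Rightarrow> real) \<Rightarrow> bool" where
  "assumption_K \<Gamma> \<longleftrightarrow> continuous_on {0..} \<Gamma> \<and> (\<forall>\<tau>\<ge>0. 0 \<le> \<Gamma> \<tau>) \<and>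
     (\<Gamma> has_integral 1) {0..} \<and> (\<lambda>\<tau>. \<tau> * \<Gamma> \<tau>) integrable_on {0..}"

text \<open>Classical solutions, on all of \<open>\<real> \<times> \<real>\<close>, of \<open>u\<^sub>t = D u\<^sub>x\<^sub>x + F(u) + w(t,x)\<close>.\<close>

definition solves_rd ::
  "real \<Rightarrow> (real \<Rightarrow> real) \<Rightarrow> (real \<Rightarrow> real \<Rightarrow> real) \<Rightarrow> (real \<Rightarrow> real \<Rightarrow> real) \<Rightarrow> bool" where
  "solves_rd D F w u \<longleftrightarrow> (\<exists>ut ux uxx. \<forall>t x.
     ((\<lambda>s. u s x) has_real_derivative ut t x) (at t) \<and>
     ((\<lambda>y. u t y) has_real_derivative ux t x) (at x) \<and>
     ((\<lambda>y. ux t y) has_real_derivative uxx t x) (at x) \<and>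
     ut t x = D * uxx t x + F (u t x) + w t x)"

definition memory_equation ::
  "real \<Rightarrow> (real \<Rightarrow> real) \<Rightarrow> (real \<Rightarrow> real) \<Rightarrow> real \<Rightarrow> (real \<Rightarrow> real \<Rightarrow> real) \<Rightarrow> bool" where
  "memory_equation D F \<Gamma> \<gamma> u \<longleftrightarrow>
     (\<forall>t x. (\<lambda>\<tau>. \<Gamma> \<tau> * u (t - \<tau>) x) integrable_on {0..}) \<and>
     solves_rd D F (\<lambda>t x. \<gamma> * integral {0..} (\<lambda>\<tau>. \<Gamma> \<tau> * u (t - \<tau>) x)) u"

definition auxiliary_equation ::
  "real \<Rightarrow> (real \<Rightarrow> real) \<Rightarrow> (real \<Rightarrow> real) \<Rightarrow> real \<Rightarrow> real \<Rightarrow> (real \<Rightarrow> real \<Rightarrow> real) \<Rightarrow> bool" where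
  "auxiliary_equation D F \<Gamma> \<gamma> v u \<longleftrightarrow>
     (\<forall>t x. (\<lambda>\<tau>. \<Gamma> \<tau> * u t (x + v * \<tau>)) integrable_on {0..}) \<and>
     solves_rd D F (\<lambda>t x. \<gamma> * integral {0..} (\<lambda>\<tau>. \<Gamma> \<tau> * u t (x + v * \<tau>))) u"

definition traveling_front ::
  "((real \<Rightarrow> real \<Rightarrow> real) \<Rightarrow> bool) \<Rightarrow> real \<Rightarrow> real \<Rightarrow> real \<Rightarrow> (real \<Rightarrow> real) \<Rightarrow> bool" where
  "traveling_front Eq l r c U \<longleftrightarrow> Eq (\<lambda>t x. U (x - c * t)) \<and>
     (U \<longlongrightarrow> l) at_bot \<and> (U \<longlongrightarrow> r) at_top"

text \<open>The wave speeds \<open>C(\<gamma>, v)\<close> and \<open>c\<^sub>\<gamma>\<close> are given by their graphs, so that statements about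
  them are made for the speed of every front, with no choice of a value in its absence.\<close>

definition is_wave_speed ::
  "real \<Rightarrow> (real \<Rightarrow> real) \<Rightarrow> (real \<Rightarrow> real) \<Rightarrow> (real \<Rightarrow> real) \<Rightarrow> (real \<Rightarrow> real) \<Rightarrow>
    real \<Rightarrow> real \<Rightarrow> real \<Rightarrow> bool" where
  "is_wave_speed D F \<Gamma> um up \<gamma> v c \<longleftrightarrow>
     (\<exists>U. traveling_front (auxiliary_equation D F \<Gamma> \<gamma> v) (um \<gamma>) (up \<gamma>) c U)"

definition is_memory_front_speed ::
  "real \<Rightarrow> (real \<Rightarrow> real) \<Rightarrow> (real \<Rightarrow> real) \<Rightarrow> (real \<Rightarrow> real) \<Rightarrow> (real \<Rightarrow> real) \<Rightarrow>
    real \<Rightarrow> real \<Rightarrow> bool" where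
  "is_memory_front_speed D F \<Gamma> um up \<gamma> c \<longleftrightarrow>
     (\<exists>U. traveling_front (memory_equation D F \<Gamma> \<gamma>) (um \<gamma>) (up \<gamma>) c U)"

end

theory Submission
  imports Defs
begin

text \<open>
  In the moving frame a front with speed \<open>c\<close> of the memory equation is a profile \<open>U\<close> with
  \<open>D U'' + c U' + f(U) + \<gamma> \<integral> \<Gamma>(\<tau>) (U(\<xi> + c \<tau>) - U(\<xi>)) d\<tau> = 0\<close>, where \<open>f = F\<^sub>\<gamma>\<close>, because \<open>\<Gamma>\<close> has mass
  one. A front of the local equation \<open>v = 0\<close> solves the same equation with the integral dropped.
  Since \<open>\<gamma> \<Gamma> \<ge> 0\<close>, the integral is monotone in the shifted values and the equation has a comparison
  principle. Everything rests on that.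

  The central tool is the sliding method (\<open>sliding\<close>). Let \<open>P\<close> be a supersolution and \<open>Q\<close> a
  subsolution of one such equation, both joining \<open>l\<close> to \<open>r\<close>. A translate of \<open>P\<close> far to the left
  lies above \<open>Q\<close>; moved back until the order is about to fail, it touches \<open>Q\<close>, and then it
  coincides with \<open>Q\<close> by the strong maximum principle. Contact cannot be lost to infinity,
  because \<open>f\<close> decreases near \<open>l\<close> and near \<open>r\<close>.

  Comparing a front with itself gives monotonicity (\<open>front_monotone\<close>). Monotonicity gives the
  integral the sign of \<open>c\<close>, and this determines the sign of \<open>c\<close>: were \<open>c < 0\<close>, the energy
  \<open>D U'\<^sup>2 / 2 + \<integral> f\<close> would increase along the front, so the integral of \<open>f\<close> over \<open>[l, r]\<close> would be
  positive (\<open>speed_nonneg_if_integral_nonpos\<close>). If \<open>c \<ge> 0\<close> and the local speed \<open>C\<close> were below \<open>c\<close>,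
  the memory front would be a supersolution of the local equation in the frame of speed \<open>C\<close>, strict
  where it increases, and could not coincide with a translate of the local front
  (\<open>speed_le_local_speed\<close>).

  The explicit bound is a two-sided estimate of the slope \<open>p\<close> of the local front at the point
  where it takes the value \<open>m\<close>. Ahead of this point \<open>f \<ge> 0\<close>, so \<open>D V' + C V\<close> decreases towards
  \<open>C r\<close> and \<open>D p \<ge> C (r - m)\<close>. Behind it \<open>f \<ge> - \<Phi>\<close>, so \<open>C V' - \<Phi>\<close> multiplied by \<open>exp (C \<xi> / D)\<close>
  decreases from \<open>0\<close> and \<open>C p \<le> \<Phi>\<close>. Together \<open>C\<^sup>2 (r - m) \<le> \<Phi> D\<close> (\<open>local_speed_le\<close>).

  The case of a nonnegative integral follows by the symmetry \<open>U(\<xi>) \<mapsto> - U(- \<xi>)\<close>,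
  \<open>f(u) \<mapsto> - f(- u)\<close>, which reverses all speeds and exchanges \<open>l\<close> with \<open>- r\<close>.
\<close>

section \<open>Profile equations with a delayed nonlocal term\<close>

definition delayed_diff :: "(real \<Rightarrow> real) \<Rightarrow> real \<Rightarrow> (real \<Rightarrow> real) \<Rightarrow> real \<Rightarrow> real" where
  "delayed_diff \<Gamma> s U \<xi> = integral {0..} (\<lambda>\<tau>. \<Gamma> \<tau> * (U (\<xi> + s * \<tau>) - U \<xi>))"

definition front_shape ::
  "(real \<Rightarrow> real) \<Rightarrow> real \<Rightarrow> real \<Rightarrow> real \<Rightarrow> (real \<Rightarrow> real) \<Rightarrow> (real \<Rightarrow> real) \<Rightarrow> (real \<Rightarrow> real) \<Rightarrow> bool"
  where
  "front_shape \<Gamma> s l r U U' U'' \<longleftrightarrow>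
     (\<forall>\<xi>. (U has_real_derivative U' \<xi>) (at \<xi>)) \<and>
     (\<forall>\<xi>. (U' has_real_derivative U'' \<xi>) (at \<xi>)) \<and>
     (\<forall>\<xi>. (\<lambda>\<tau>. \<Gamma> \<tau> * U (\<xi> + s * \<tau>)) integrable_on {0..}) \<and>
     (U \<longlongrightarrow> l) at_bot \<and> (U \<longlongrightarrow> r) at_top"

text \<open>
  The shift rate \<open>s\<close> is kept apart from the speed \<open>c\<close>: memory fronts have \<open>s = c\<close>, local fronts
  have \<open>s = 0\<close>, and comparing the two means reading a memory front as a profile with \<open>s = 0\<close>.
  A nonpositive residual makes \<open>U\<close> a supersolution, a nonnegative one a subsolution.
\<close>

definition residual ::
  "real \<Rightarrow> (real \<Rightarrow> real) \<Rightarrow> real \<Rightarrow> (real \<Rightarrow> real) \<Rightarrow> real \<Rightarrow> real \<Rightarrow>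
    (real \<Rightarrow> real) \<Rightarrow> (real \<Rightarrow> real) \<Rightarrow> (real \<Rightarrow> real) \<Rightarrow> real \<Rightarrow> real" where
  "residual D f \<gamma> \<Gamma> s c U U' U'' \<xi> =
     D * U'' \<xi> + c * U' \<xi> + f (U \<xi>) + \<gamma> * delayed_diff \<Gamma> s U \<xi>"

definition front_profile ::
  "real \<Rightarrow> (real \<Rightarrow> real) \<Rightarrow> real \<Rightarrow> (real \<Rightarrow> real) \<Rightarrow> real \<Rightarrow> real \<Rightarrow> real \<Rightarrow> real \<Rightarrow>
    (real \<Rightarrow> real) \<Rightarrow> (real \<Rightarrow> real) \<Rightarrow> (real \<Rightarrow> real) \<Rightarrow> bool" where
  "front_profile D f \<gamma> \<Gamma> s l r c U U' U'' \<longleftrightarrow>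
     front_shape \<Gamma> s l r U U' U'' \<and> (\<forall>\<xi>. residual D f \<gamma> \<Gamma> s c U U' U'' \<xi> = 0)"

lemma delayed_diff_zero_shift [simp]: "delayed_diff \<Gamma> 0 U \<xi> = 0"
  by (simp add: delayed_diff_def)

section \<open>Real functions of one variable\<close>

lemma global_min_below_limits:
  fixes W :: "real \<Rightarrow> real"
  assumes cont: "continuous_on UNIV W"
    and bot: "(W \<longlongrightarrow> a) at_bot" and top: "(W \<longlongrightarrow> b) at_top"
    and below: "W x1 < a" "W x1 < b"
  obtains x0 where "\<And>x. W x0 \<le> W x"
proof -
  have "\<forall>\<^sub>F x in at_bot. W x > W x1" using order_tendstoD(1)[OF bot below(1)] .
  then obtain A where A: "\<And>x. x \<le> A \<Longrightarrow> W x > W x1" by (auto simp: eventually_at_bot_linorder)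
  have "\<forall>\<^sub>F x in at_top. W x > W x1" using order_tendstoD(1)[OF top below(2)] .
  then obtain B where B: "\<And>x. x \<ge> B \<Longrightarrow> W x > W x1" by (auto simp: eventually_at_top_linorder)
  have "A < x1" "x1 < B" using A[of x1] B[of x1] by force+
  then have "x1 \<in> {A..B}" by simp
  moreover obtain x0 where "x0 \<in> {A..B}" and min: "\<And>x. x \<in> {A..B} \<Longrightarrow> W x0 \<le> W x"
    using continuous_attains_inf[of "{A..B}" W] continuous_on_subset[OF cont] calculation
    by (metis compact_Icc empty_iff subset_UNIV)
  ultimately have "W x0 \<le> W x" for x
    using A[of x] B[of x] min[of x] min[of x1] by (cases "x \<le> A \<or> x \<ge> B") fastforce+
  then show ?thesis using that by blast
qed

lemma derivatives_at_min:
  fixes W W' :: "real \<Rightarrow> real"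
  assumes W: "\<And>x. (W has_real_derivative W' x) (at x)"
    and W': "(W' has_real_derivative w) (at x0)"
    and min: "\<And>x. W x0 \<le> W x"
  shows "W' x0 = 0" "0 \<le> w"
proof -
  show z: "W' x0 = 0" by (rule DERIV_local_min[OF W, of 1]) (auto simp: min)
  show "0 \<le> w"
  proof (rule ccontr)
    assume "\<not> 0 \<le> w"
    then obtain d where d: "d > 0" "\<And>h. \<lbrakk>0 < h; h < d\<rbrakk> \<Longrightarrow> W' (x0 + h) < W' x0"
      using DERIV_neg_dec_right[OF W'] by force
    obtain z where "x0 < z" "z < x0 + d/2" "W (x0 + d/2) - W x0 = (x0 + d/2 - x0) * W' z"
      using MVT2[of x0 "x0 + d/2" W W'] W d by auto
    moreover have "W' z < 0" using d(2)[of "z - x0"] z calculation d(1) by auto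
    moreover have "(d/2) * W' z < 0" using d(1) calculation by (intro mult_pos_neg) auto
    ultimately have "W (x0 + d/2) < W x0" by simp
    then show False using min[of "x0 + d/2"] by simp
  qed
qed

text \<open>
  With \<open>p\<^sub>1\<close>, \<open>p\<^sub>2\<close> the (real) roots of \<open>D p\<^sup>2 + c p - k\<close>, the operator \<open>D W'' + c W' - k W\<close> factors
  into first-order operators. Each factor becomes a monotonicity statement after multiplication by an
  exponential: first for \<open>W' - p\<^sub>2 W\<close>, which vanishes at \<open>x\<^sub>0\<close> because \<open>x\<^sub>0\<close> is a minimum, and then
  for \<open>W\<close> itself, on both sides of \<open>x\<^sub>0\<close>.
\<close>

lemma strong_minimum_principle:
  fixes W W' W'' :: "real \<Rightarrow> real"
  assumes D: "D > 0" and k: "k \<ge> 0"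
    and W: "\<And>x. (W has_real_derivative W' x) (at x)"
    and W': "\<And>x. (W' has_real_derivative W'' x) (at x)"
    and nonneg: "\<And>x. 0 \<le> W x"
    and ineq: "\<And>x. D * W'' x + c * W' x \<le> k * W x"
    and zero: "W x0 = 0"
  shows "W x = 0"
proof -
  define q where "q = sqrt (c\<^sup>2 + 4 * D * k)"
  define p1 where "p1 = (- c - q) / (2 * D)"
  define p2 where "p2 = (- c + q) / (2 * D)"
  have q2: "q\<^sup>2 = c\<^sup>2 + 4 * D * k" unfolding q_def using D k by simp
  have sum: "D * (p1 + p2) = - c" unfolding p1_def p2_def using D by (simp add: field_simps)
  have "D * p1 * p2 = (c\<^sup>2 - q\<^sup>2) / (4 * D)"
    unfolding p1_def p2_def using D by (simp add: field_simps power2_eq_square)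
  then have prod: "D * p1 * p2 = - k" unfolding q2 using D by (simp add: field_simps)
  have crit: "W' x0 = 0" using derivatives_at_min(1)[OF W W'] zero nonneg by simp
  define Z where "Z = (\<lambda>y. exp (- p1 * y) * (W' y - p2 * W y))"
  have Zd: "(Z has_real_derivative exp (- p1 * y) * (W'' y - (p1 + p2) * W' y + p1 * p2 * W y)) (at y)" for y
    unfolding Z_def by (auto intro!: derivative_eq_intros W W' simp: algebra_simps)
  have "D * (W'' y - (p1 + p2) * W' y + p1 * p2 * W y) = D * W'' y + c * W' y - k * W y" for y
  proof -
    have "D * (W'' y - (p1 + p2) * W' y + p1 * p2 * W y) =
        D * W'' y - (D * (p1 + p2)) * W' y + (D * p1 * p2) * W y" by (simp add: algebra_simps)
    then show ?thesis unfolding sum prod by simp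
  qed
  then have Zneg: "W'' y - (p1 + p2) * W' y + p1 * p2 * W y \<le> 0" for y
    using ineq[of y] D by (smt (verit) mult_pos_pos)
  have Zdec: "Z y \<ge> Z z" if "y \<le> z" for y z
    by (rule DERIV_nonpos_imp_nonincreasing[OF that])
       (rule exI, rule conjI, rule Zd, rule mult_nonneg_nonpos[OF exp_ge_zero Zneg])
  have Z0: "Z x0 = 0" unfolding Z_def crit zero by simp
  define Y where "Y = (\<lambda>y. exp (- p2 * y) * W y)"
  have Yd: "(Y has_real_derivative exp (- p2 * y) * (W' y - p2 * W y)) (at y)" for y
    unfolding Y_def by (auto intro!: derivative_eq_intros W W' simp: algebra_simps)
  have Y0: "Y x0 = 0" unfolding Y_def zero by simp
  have "Y x \<le> Y x0"
  proof (cases "x \<ge> x0")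
    case True
    have "W' y - p2 * W y \<le> 0" if "y \<ge> x0" for y
      using Zdec[OF that] Z0 unfolding Z_def by (simp add: mult_le_0_iff)
    then have "\<exists>d. (Y has_real_derivative d) (at y) \<and> d \<le> 0" if "y \<ge> x0" for y
      using Yd[of y] that by (meson exp_ge_zero mult_nonneg_nonpos)
    then show ?thesis
      by - (rule DERIV_nonpos_imp_nonincreasing[OF True], simp)
  next
    case False
    have "W' y - p2 * W y \<ge> 0" if "y \<le> x0" for y
      using Zdec[OF that] Z0 unfolding Z_def by (simp add: zero_le_mult_iff)
    then have "\<exists>d. (Y has_real_derivative d) (at y) \<and> 0 \<le> d" if "y \<le> x0" for y
      using Yd[of y] that by (meson exp_ge_zero mult_nonneg_nonneg)
    then show ?thesis
      by - (rule DERIV_nonneg_imp_nondecreasing[of x x0], use False in simp_all)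
  qed
  then have "Y x \<le> 0" using Y0 by simp
  then have "W x \<le> 0" unfolding Y_def by (simp add: mult_le_0_iff)
  with nonneg[of x] show ?thesis by simp
qed

text \<open>
  A convergent function need not have a convergent derivative, but the mean value theorem on unit
  intervals supplies points along which the derivative tends to zero; for boundary terms at
  infinity of monotone quantities this is enough.
\<close>

lemma derivative_vanishes_along_sequences:
  fixes U U' :: "real \<Rightarrow> real"
  assumes U: "\<And>x. (U has_real_derivative U' x) (at x)"
    and bot: "(U \<longlongrightarrow> l) at_bot" and top: "(U \<longlongrightarrow> r) at_top"
  obtains y z :: "nat \<Rightarrow> real"
  where "filterlim y at_bot sequentially" "(\<lambda>n. U' (y n)) \<longlonglongrightarrow> 0"
    "filterlim z at_top sequentially" "(\<lambda>n. U' (z n)) \<longlonglongrightarrow> 0"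
proof -
  have "\<exists>z. a < z \<and> z < a + 1 \<and> U' z = U (a + 1) - U a" for a
    using MVT2[of a "a + 1" U U'] U by auto
  then obtain p where p: "\<And>a. a < p a" "\<And>a. p a < a + 1" "\<And>a. U' (p a) = U (a + 1) - U a"
    by metis
  have t1: "filterlim (\<lambda>n. real n) at_top sequentially" by (rule filterlim_real_sequentially)
  have t2: "filterlim (\<lambda>n. real n + 1) at_top sequentially"
    by (rule filterlim_at_top_mono[OF t1]) simp
  have b1: "filterlim (\<lambda>n. - real n) at_bot sequentially"
    using t1 by (simp add: filterlim_uminus_at_top)
  have b2: "filterlim (\<lambda>n. - (real n + 1)) at_bot sequentially"
    using t2 by (simp add: filterlim_uminus_at_top)
  show ?thesis
  proof
    show "filterlim (\<lambda>n. p (real n)) at_top sequentially"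
      by (rule filterlim_at_top_mono[OF t1]) (intro always_eventually allI less_imp_le p(1))
    show "filterlim (\<lambda>n. p (- (real n + 1))) at_bot sequentially"
    proof (rule filterlim_at_bot_mono[OF b1], intro always_eventually allI)
      show "p (- (real n + 1)) \<le> - real n" for n using p(2)[of "- (real n + 1)"] by simp
    qed
    have "(\<lambda>n. U (real n + 1) - U (real n)) \<longlonglongrightarrow> r - r"
      by (intro tendsto_diff filterlim_compose[OF top t1] filterlim_compose[OF top t2])
    then show "(\<lambda>n. U' (p (real n))) \<longlonglongrightarrow> 0" by (simp add: p(3))
    have "(\<lambda>n. U (- real n) - U (- (real n + 1))) \<longlonglongrightarrow> l - l"
      by (intro tendsto_diff filterlim_compose[OF bot b1] filterlim_compose[OF bot b2])
    then show "(\<lambda>n. U' (p (- (real n + 1)))) \<longlonglongrightarrow> 0" by (simp add: p(3))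
  qed
qed

lemma mono_between_sequential_limits:
  fixes E :: "real \<Rightarrow> real"
  assumes mono: "mono E"
    and y: "filterlim y at_bot sequentially" "(\<lambda>n::nat. E (y n)) \<longlonglongrightarrow> a"
    and z: "filterlim z at_top sequentially" "(\<lambda>n::nat. E (z n)) \<longlonglongrightarrow> b"
  shows "a \<le> E x" "E x \<le> b"
proof -
  have "\<forall>\<^sub>F n in sequentially. E (y n) \<le> E x"
    using y(1) unfolding filterlim_at_bot by (auto elim!: allE[of _ x] eventually_mono intro: monoD[OF mono])
  then show "a \<le> E x" by (intro tendsto_upperbound[OF y(2)]) auto
  have "\<forall>\<^sub>F n in sequentially. E x \<le> E (z n)"
    using z(1) unfolding filterlim_at_top by (auto elim!: allE[of _ x] eventually_mono intro: monoD[OF mono])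
  then show "E x \<le> b" by (intro tendsto_lowerbound[OF z(2)]) auto
qed

lemma no_period_if_limits_differ:
  fixes U :: "real \<Rightarrow> real"
  assumes bot: "(U \<longlongrightarrow> l) at_bot" and top: "(U \<longlongrightarrow> r) at_top" and "l \<noteq> r"
    and per: "\<And>x. U (x + h) = U x"
  shows "h = 0"
proof (rule ccontr)
  assume h: "h \<noteq> 0"
  have per': "U (x + \<bar>h\<bar>) = U x" for x using per[of x] per[of "x - h"] by (cases "h \<ge> 0") auto
  have up: "U (real n * \<bar>h\<bar>) = U 0" for n
  proof (induction n)
    case (Suc n)
    then show ?case using per'[of "real n * \<bar>h\<bar>"] by (simp add: algebra_simps)
  qed simp
  have down: "U (- (real n * \<bar>h\<bar>)) = U 0" for n
  proof (induction n)
    case (Suc n)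
    then show ?case using per'[of "- (real (Suc n) * \<bar>h\<bar>)"] by (simp add: algebra_simps)
  qed simp
  have t: "filterlim (\<lambda>n. real n * \<bar>h\<bar>) at_top sequentially"
    using h by (intro filterlim_at_top_mult_tendsto_pos[OF tendsto_const _ filterlim_real_sequentially, of "\<bar>h\<bar>"]) auto
  then have b: "filterlim (\<lambda>n. - (real n * \<bar>h\<bar>)) at_bot sequentially"
    by (simp add: filterlim_uminus_at_top)
  have "(\<lambda>n. U 0) \<longlonglongrightarrow> r" using filterlim_compose[OF top t] unfolding up .
  moreover have "(\<lambda>n. U 0) \<longlonglongrightarrow> l" using filterlim_compose[OF bot b] unfolding down .
  ultimately show False using \<open>l \<noteq> r\<close> by (metis LIMSEQ_const_iff)
qed

lemma no_zero_keeps_sign: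
  fixes g :: "real \<Rightarrow> real"
  assumes "continuous_on UNIV g" and S: "connected S" and nz: "\<And>x. x \<in> S \<Longrightarrow> g x \<noteq> 0"
    and "a \<in> S" "x \<in> S" "0 < g a"
  shows "0 < g x"
proof (rule ccontr)
  assume "\<not> 0 < g x"
  moreover have "connected (g ` S)"
    using connected_continuous_image[OF continuous_on_subset[OF assms(1)] S] by simp
  ultimately have "0 \<in> g ` S"
    using assms(4-6) connected_contains_Icc[of "g ` S" "g x" "g a"] by force
  then show False using nz by auto
qed

section \<open>The reflection symmetry\<close>

lemma front_shape_reflect:
  assumes "front_shape \<Gamma> s l r U U' U''"
  shows "front_shape \<Gamma> (- s) (- r) (- l) (\<lambda>\<xi>. - U (- \<xi>)) (\<lambda>\<xi>. U' (- \<xi>)) (\<lambda>\<xi>. - U'' (- \<xi>))"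
proof -
  have d: "\<And>\<xi>. (U has_real_derivative U' \<xi>) (at \<xi>)" "\<And>\<xi>. (U' has_real_derivative U'' \<xi>) (at \<xi>)"
    and i: "\<And>\<xi>. (\<lambda>\<tau>. \<Gamma> \<tau> * U (\<xi> + s * \<tau>)) integrable_on {0..}"
    and lim: "(U \<longlongrightarrow> l) at_bot" "(U \<longlongrightarrow> r) at_top"
    using assms unfolding front_shape_def by auto
  have "((\<lambda>\<xi>. - U (- \<xi>)) has_real_derivative U' (- \<xi>)) (at \<xi>)"
       "((\<lambda>\<xi>. U' (- \<xi>)) has_real_derivative - U'' (- \<xi>)) (at \<xi>)" for \<xi>
    using DERIV_minus[OF d(1)[of "- \<xi>", unfolded DERIV_mirror]] d(2)[of "- \<xi>"]
    by (simp_all add: DERIV_mirror)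
  moreover have "(\<lambda>\<tau>. \<Gamma> \<tau> * - U (- (\<xi> + - s * \<tau>))) integrable_on {0..}" for \<xi>
    using integrable_neg[OF i[of "- \<xi>"]] by simp
  moreover have "((\<lambda>\<xi>. U (- \<xi>)) \<longlongrightarrow> r) at_bot" "((\<lambda>\<xi>. U (- \<xi>)) \<longlongrightarrow> l) at_top"
    using lim unfolding filterlim_at_bot_mirror[of "\<lambda>\<xi>. U (- \<xi>)"]
      filterlim_at_top_mirror[of "\<lambda>\<xi>. U (- \<xi>)"] by simp_all
  ultimately show ?thesis unfolding front_shape_def
    by (auto intro: tendsto_minus)
qed

lemma residual_reflect:
  "residual D (\<lambda>u. - f (- u)) \<gamma> \<Gamma> (- s) (- c) (\<lambda>\<xi>. - U (- \<xi>)) (\<lambda>\<xi>. U' (- \<xi>)) (\<lambda>\<xi>. - U'' (- \<xi>)) \<xi>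
    = - residual D f \<gamma> \<Gamma> s c U U' U'' (- \<xi>)"
proof -
  have "(\<lambda>\<tau>. \<Gamma> \<tau> * (- U (- (\<xi> + - s * \<tau>)) - - U (- \<xi>)))
      = (\<lambda>\<tau>. - (\<Gamma> \<tau> * (U (- \<xi> + s * \<tau>) - U (- \<xi>))))"
    by (rule ext) (simp add: right_diff_distrib)
  then have "delayed_diff \<Gamma> (- s) (\<lambda>\<xi>. - U (- \<xi>)) \<xi> = - delayed_diff \<Gamma> s U (- \<xi>)"
    unfolding delayed_diff_def by simp
  then show ?thesis unfolding residual_def by simp
qed

lemma front_profile_reflect:
  assumes "front_profile D f \<gamma> \<Gamma> s l r c U U' U''"
  shows "front_profile D (\<lambda>u. - f (- u)) \<gamma> \<Gamma> (- s) (- r) (- l) (- c)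
    (\<lambda>\<xi>. - U (- \<xi>)) (\<lambda>\<xi>. U' (- \<xi>)) (\<lambda>\<xi>. - U'' (- \<xi>))"
  using assms unfolding front_profile_def by (simp add: front_shape_reflect residual_reflect)

section \<open>Bistable nonlinearities and nonnegative kernels\<close>

locale bistable_delay =
  fixes D \<gamma> :: real and \<Gamma> f f' :: "real \<Rightarrow> real" and l m r :: real
  assumes D_pos: "D > 0" and \<gamma>_nonneg: "\<gamma> \<ge> 0"
    and \<Gamma>_nonneg: "\<And>\<tau>. \<tau> \<ge> 0 \<Longrightarrow> \<Gamma> \<tau> \<ge> 0"
    and \<Gamma>_mass: "(\<Gamma> has_integral 1) {0..}"
    and f_deriv: "\<And>u. (f has_real_derivative f' u) (at u)"
    and f'_cont: "continuous_on UNIV f'"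
    and zeros: "{u. f u = 0} = {l, m, r}" and lm: "l < m" and mr: "m < r"
    and stable: "f' l < 0" "f' r < 0"
begin

lemma l_less_r: "l < r" using lm mr by simp

lemma f_zero_iff: "f u = 0 \<longleftrightarrow> u = l \<or> u = m \<or> u = r"
  using zeros by auto

lemma f_cont: "continuous_on A f"
  by (meson DERIV_isCont continuous_at_imp_continuous_on f_deriv)

text \<open>
  The negative slope at an outer zero fixes the sign of \<open>f\<close> on either side of it, and the absence of
  further zeros carries this sign across the adjacent interval.
\<close>

lemma f_pos_below: "0 < f u" if "u < l"
proof -
  obtain d where "d > 0" "\<And>h. \<lbrakk>0 < h; h < d\<rbrakk> \<Longrightarrow> f (l - h) > f l"
    using DERIV_neg_dec_left[OF f_deriv stable(1)] by blast
  from this(2)[of "d/2"] this(1) have "0 < f (l - d/2)" using f_zero_iff[of l] by auto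
  then show ?thesis
    using no_zero_keeps_sign[OF f_cont, of "{..<l}" "l - d/2" u] that f_zero_iff lm mr \<open>d > 0\<close>
    by auto
qed

lemma f_neg_above: "f u < 0" if "u > r"
proof -
  obtain d where "d > 0" "\<And>h. \<lbrakk>0 < h; h < d\<rbrakk> \<Longrightarrow> f (r + h) < f r"
    using DERIV_neg_dec_right[OF f_deriv stable(2)] by blast
  from this(2)[of "d/2"] this(1) have "f (r + d/2) < 0" using f_zero_iff[of r] by auto
  then show ?thesis
    using no_zero_keeps_sign[of "\<lambda>u. - f u" "{r<..}" "r + d/2" u] that f_zero_iff lm mr \<open>d > 0\<close>
    by (auto intro: continuous_intros f_cont)
qed

lemma f_pos_upper: "0 < f u" if "m < u" "u < r"
proof -
  obtain d where d: "d > 0" "\<And>h. \<lbrakk>0 < h; h < d\<rbrakk> \<Longrightarrow> f (r - h) > f r"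
    using DERIV_neg_dec_left[OF f_deriv stable(2)] by blast
  define h where "h = min (d/2) ((r - m)/2)"
  have h: "0 < h" "h < d" "m < r - h" using d(1) mr unfolding h_def by (auto simp: min_def field_simps)
  from d(2)[OF h(1,2)] have "0 < f (r - h)" using f_zero_iff[of r] by auto
  then show ?thesis
    using no_zero_keeps_sign[OF f_cont, of "{m<..<r}" "r - h" u] that f_zero_iff lm mr h by auto
qed

lemma f_decreasing_near_zeros:
  obtains \<delta> where "\<delta> > 0"
    "\<And>u v. \<lbrakk>l \<le> u; u < v; v \<le> l + \<delta>\<rbrakk> \<Longrightarrow> f v < f u"
    "\<And>u v. \<lbrakk>r - \<delta> \<le> u; u < v; v \<le> r\<rbrakk> \<Longrightarrow> f v < f u"
proof -
  have near: "\<exists>d>0. \<forall>u. \<bar>u - a\<bar> < d \<longrightarrow> f' u < 0" if "f' a < 0" for a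
  proof -
    have "(f' \<longlongrightarrow> f' a) (at a)" using f'_cont by (simp add: continuous_on_def)
    then have "\<forall>\<^sub>F u in at a. f' u < 0" using order_tendstoD(2) that by blast
    then show ?thesis unfolding eventually_at using that by (metis dist_real_def UNIV_I)
  qed
  obtain d1 where d1: "d1 > 0" "\<And>u. \<bar>u - l\<bar> < d1 \<Longrightarrow> f' u < 0" using near[OF stable(1)] by blast
  obtain d2 where d2: "d2 > 0" "\<And>u. \<bar>u - r\<bar> < d2 \<Longrightarrow> f' u < 0" using near[OF stable(2)] by blast
  show ?thesis
  proof (rule that[of "min d1 d2 / 2"])
    show "min d1 d2 / 2 > 0" using d1 d2 by simp
    show "f v < f u" if "l \<le> u" "u < v" "v \<le> l + min d1 d2 / 2" for u v
    proof (rule DERIV_neg_imp_decreasing[OF that(2)])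
      show "\<exists>y. (f has_real_derivative y) (at x) \<and> y < 0" if "u \<le> x" "x \<le> v" for x
        using d1 d2(1) f_deriv[of x] that \<open>l \<le> u\<close> \<open>v \<le> _\<close> by (intro exI[of _ "f' x"]) auto
    qed
    show "f v < f u" if "r - min d1 d2 / 2 \<le> u" "u < v" "v \<le> r" for u v
    proof (rule DERIV_neg_imp_decreasing[OF that(2)])
      show "\<exists>y. (f has_real_derivative y) (at x) \<and> y < 0" if "u \<le> x" "x \<le> v" for x
        using d2 d1(1) f_deriv[of x] that \<open>v \<le> r\<close> \<open>_ \<le> u\<close> by (intro exI[of _ "f' x"]) auto
    qed
  qed
qed

lemma f_one_sided_lipschitz:
  obtains K where "K \<ge> 0" "\<And>u v. \<lbrakk>l \<le> u; u \<le> v; v \<le> r\<rbrakk> \<Longrightarrow> - K * (v - u) \<le> f v - f u"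
proof -
  have "compact (f' ` {l..r})"
    by (rule compact_continuous_image) (auto intro: continuous_on_subset[OF f'_cont])
  then obtain K where K: "\<And>u. u \<in> {l..r} \<Longrightarrow> \<bar>f' u\<bar> \<le> K"
    by (metis (no_types, lifting) compact_imp_bounded bounded_iff imageI real_norm_def)
  show ?thesis
  proof (rule that[of K])
    show "K \<ge> 0" using K[of l] l_less_r by force
    show "- K * (v - u) \<le> f v - f u" if "l \<le> u" "u \<le> v" "v \<le> r" for u v
    proof (cases "u = v")
      case False
      then have "u < v" using that by simp
      then obtain z where z: "u < z" "z < v" "f v - f u = (v - u) * f' z"
        using MVT2[OF _ f_deriv] by blast
      have "- K \<le> f' z" using K[of z] z that by auto
      then have "(v - u) * (- K) \<le> (v - u) * f' z" using that by (intro mult_left_mono) auto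
      then show ?thesis using z(3) by (simp add: algebra_simps)
    qed simp
  qed
qed

lemma \<Gamma>_const_integrable: "(\<lambda>\<tau>. \<Gamma> \<tau> * k) integrable_on {0..}"
  using \<Gamma>_mass by (intro integrable_on_mult_left) (auto simp: has_integral_integrable)

lemma delayed_diff_eq:
  assumes "(\<lambda>\<tau>. \<Gamma> \<tau> * U (\<xi> + s * \<tau>)) integrable_on {0..}"
  shows "delayed_diff \<Gamma> s U \<xi> = integral {0..} (\<lambda>\<tau>. \<Gamma> \<tau> * U (\<xi> + s * \<tau>)) - U \<xi>"
proof -
  have "integral {0..} (\<lambda>\<tau>. \<Gamma> \<tau> * U \<xi>) = U \<xi>"
    using integral_unique[OF has_integral_mult_left[OF \<Gamma>_mass, of "U \<xi>"]] by (simp only: mult_1_left)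
  then show ?thesis
    unfolding delayed_diff_def right_diff_distrib
    using integral_diff[OF assms \<Gamma>_const_integrable] by simp
qed

lemma delayed_diff_integrable:
  assumes "(\<lambda>\<tau>. \<Gamma> \<tau> * U (\<xi> + s * \<tau>)) integrable_on {0..}"
  shows "(\<lambda>\<tau>. \<Gamma> \<tau> * (U (\<xi> + s * \<tau>) - U \<xi>)) integrable_on {0..}"
  unfolding right_diff_distrib by (intro integrable_diff assms \<Gamma>_const_integrable)

lemma delayed_diff_nonneg:
  assumes "(\<lambda>\<tau>. \<Gamma> \<tau> * U (\<xi> + s * \<tau>)) integrable_on {0..}"
    and "\<And>\<tau>. \<tau> \<ge> 0 \<Longrightarrow> U \<xi> \<le> U (\<xi> + s * \<tau>)"
  shows "0 \<le> delayed_diff \<Gamma> s U \<xi>"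
  unfolding delayed_diff_def
  by (rule integral_nonneg[OF delayed_diff_integrable[OF assms(1)]]) (use assms \<Gamma>_nonneg in auto)

lemma delayed_diff_nonpos:
  assumes "(\<lambda>\<tau>. \<Gamma> \<tau> * U (\<xi> + s * \<tau>)) integrable_on {0..}"
    and "\<And>\<tau>. \<tau> \<ge> 0 \<Longrightarrow> U (\<xi> + s * \<tau>) \<le> U \<xi>"
  shows "delayed_diff \<Gamma> s U \<xi> \<le> 0"
proof -
  have "delayed_diff \<Gamma> s U \<xi> \<le> integral {0..} (\<lambda>\<tau>. \<Gamma> \<tau> * 0)"
    unfolding delayed_diff_def
    by (rule integral_le[OF delayed_diff_integrable[OF assms(1)] \<Gamma>_const_integrable])
       (intro mult_left_mono, use assms(2) \<Gamma>_nonneg in simp_all)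
  then show ?thesis by simp
qed

section \<open>Comparison of fronts by sliding\<close>

text \<open>
  At a global minimum below \<open>l\<close> the diffusion and the nonlocal term are nonnegative, while \<open>f\<close> is
  positive there.
\<close>

lemma front_ge_l:
  assumes U: "front_shape \<Gamma> s l r U U' U''"
    and super: "\<And>\<xi>. residual D f \<gamma> \<Gamma> s c U U' U'' \<xi> \<le> 0"
  shows "l \<le> U \<xi>"
proof (rule ccontr)
  assume neg: "\<not> l \<le> U \<xi>"
  have d: "\<And>\<xi>. (U has_real_derivative U' \<xi>) (at \<xi>)" "\<And>\<xi>. (U' has_real_derivative U'' \<xi>) (at \<xi>)"
    and i: "\<And>\<xi>. (\<lambda>\<tau>. \<Gamma> \<tau> * U (\<xi> + s * \<tau>)) integrable_on {0..}"
    and lim: "(U \<longlongrightarrow> l) at_bot" "(U \<longlongrightarrow> r) at_top"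
    using U unfolding front_shape_def by auto
  have "continuous_on UNIV U" using d(1) by (meson DERIV_isCont continuous_at_imp_continuous_on)
  then obtain x0 where min: "\<And>x. U x0 \<le> U x"
    using global_min_below_limits[OF _ lim, of \<xi>] neg l_less_r by auto
  have "0 \<le> delayed_diff \<Gamma> s U x0" by (rule delayed_diff_nonneg[OF i]) (rule min)
  moreover have "U' x0 = 0" "0 \<le> U'' x0" using derivatives_at_min[OF d(1) d(2) min] by auto
  moreover have "0 < f (U x0)" using min[of \<xi>] neg by (intro f_pos_below) simp
  moreover have "0 \<le> D * U'' x0" "0 \<le> \<gamma> * delayed_diff \<Gamma> s U x0"
    using calculation D_pos \<gamma>_nonneg by auto
  ultimately show False using super[of x0] unfolding residual_def by simp
qed

lemma reflected: "bistable_delay D \<gamma> \<Gamma> (\<lambda>u. - f (- u)) (\<lambda>u. f' (- u)) (- r) (- m) (- l)"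
proof
  show "((\<lambda>u. - f (- u)) has_real_derivative f' (- u)) (at u)" for u
    using DERIV_minus[OF f_deriv[of "- u", unfolded DERIV_mirror]] by simp
  show "continuous_on UNIV (\<lambda>u. f' (- u))"
    by (intro continuous_on_compose2[OF f'_cont] continuous_intros) auto
  have "- f (- u) = 0 \<longleftrightarrow> u \<in> {- r, - m, - l}" for u using f_zero_iff[of "- u"] by auto
  then show "{u. - f (- u) = 0} = {- r, - m, - l}" by blast
qed (use D_pos \<gamma>_nonneg \<Gamma>_nonneg \<Gamma>_mass lm mr stable in auto)

lemma front_le_r:
  assumes U: "front_shape \<Gamma> s l r U U' U''"
    and sub: "\<And>\<xi>. 0 \<le> residual D f \<gamma> \<Gamma> s c U U' U'' \<xi>"
  shows "U \<xi> \<le> r"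
proof -
  interpret R: bistable_delay D \<gamma> \<Gamma> "\<lambda>u. - f (- u)" "\<lambda>u. f' (- u)" "- r" "- m" "- l"
    by (rule reflected)
  have "- r \<le> - U (- (- \<xi>))"
    by (rule R.front_ge_l[OF front_shape_reflect[OF U], of "- c"]) (simp add: residual_reflect sub)
  then show ?thesis by simp
qed

text \<open>
  The translate of \<open>P\<close> by \<open>h\<close> is compared with \<open>Q\<close> through \<open>W h\<close>. A negative minimum of \<open>W h\<close> can lie
  only in a bounded region, since in the tails both values lie where \<open>f\<close> decreases and the difference
  inequality is violated. For large \<open>h\<close> this region is empty. At the infimum \<open>h0\<close> of the shifts from
  which on the order persists, \<open>W h0\<close> must vanish somewhere, for otherwise compactness would allow a
  slightly smaller shift; by the strong minimum principle it then vanishes identically.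
\<close>

lemma sliding:
  assumes P: "front_shape \<Gamma> s l r P P' P''" and Q: "front_shape \<Gamma> s l r Q Q' Q''"
    and super: "\<And>\<xi>. residual D f \<gamma> \<Gamma> s c P P' P'' \<xi> \<le> 0"
    and sub: "\<And>\<xi>. 0 \<le> residual D f \<gamma> \<Gamma> s c Q Q' Q'' \<xi>"
    and P_le: "\<And>\<xi>. P \<xi> \<le> r" and Q_ge: "\<And>\<xi>. l \<le> Q \<xi>"
  obtains h0 where "\<And>\<xi>. P (\<xi> + h0) = Q \<xi>" "\<And>h \<xi>. h0 \<le> h \<Longrightarrow> Q \<xi> \<le> P (\<xi> + h)"
proof -
  have Pd: "\<And>\<xi>. (P has_real_derivative P' \<xi>) (at \<xi>)" "\<And>\<xi>. (P' has_real_derivative P'' \<xi>) (at \<xi>)"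
    and Pi: "\<And>\<xi>. (\<lambda>\<tau>. \<Gamma> \<tau> * P (\<xi> + s * \<tau>)) integrable_on {0..}"
    and Pbot: "(P \<longlongrightarrow> l) at_bot" and Ptop: "(P \<longlongrightarrow> r) at_top"
    using P unfolding front_shape_def by auto
  have Qd: "\<And>\<xi>. (Q has_real_derivative Q' \<xi>) (at \<xi>)" "\<And>\<xi>. (Q' has_real_derivative Q'' \<xi>) (at \<xi>)"
    and Qi: "\<And>\<xi>. (\<lambda>\<tau>. \<Gamma> \<tau> * Q (\<xi> + s * \<tau>)) integrable_on {0..}"
    and Qbot: "(Q \<longlongrightarrow> l) at_bot" and Qtop: "(Q \<longlongrightarrow> r) at_top"
    using Q unfolding front_shape_def by auto
  have P_ge: "l \<le> P \<xi>" for \<xi> by (rule front_ge_l[OF P super])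
  have Q_le: "Q \<xi> \<le> r" for \<xi> by (rule front_le_r[OF Q sub])
  have Pcont: "continuous_on A P" for A
    by (meson DERIV_isCont continuous_at_imp_continuous_on Pd(1))
  define W where "W h \<xi> = P (\<xi> + h) - Q \<xi>" for h \<xi>
  have Wd: "(W h has_real_derivative P' (\<xi> + h) - Q' \<xi>) (at \<xi>)" for h \<xi>
    unfolding W_def using DERIV_diff[OF Pd(1)[of "\<xi> + h", unfolded DERIV_shift] Qd(1)] by simp
  have Wd': "((\<lambda>\<xi>. P' (\<xi> + h) - Q' \<xi>) has_real_derivative P'' (\<xi> + h) - Q'' \<xi>) (at \<xi>)" for h \<xi>
    using DERIV_diff[OF Pd(2)[of "\<xi> + h", unfolded DERIV_shift] Qd(2)] by simp
  have Wcont: "continuous_on A (W h)" for A h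
    by (meson DERIV_isCont continuous_at_imp_continuous_on Wd)
  have "filterlim (\<lambda>\<xi>. \<xi> + h) at_bot at_bot" "filterlim (\<lambda>\<xi>. \<xi> + h) at_top at_top" for h :: real
    unfolding filterlim_at_bot filterlim_at_top eventually_at_bot_linorder eventually_at_top_linorder
    by (metis le_diff_eq, metis diff_le_eq)
  note shift = this
  have Wbot: "(W h \<longlongrightarrow> 0) at_bot" for h
    using tendsto_diff[OF filterlim_compose[OF Pbot shift(1)] Qbot] unfolding W_def[abs_def] by simp
  have Wtop: "(W h \<longlongrightarrow> 0) at_top" for h
    using tendsto_diff[OF filterlim_compose[OF Ptop shift(2)] Qtop] unfolding W_def[abs_def] by simp
  have Pi': "(\<lambda>\<tau>. \<Gamma> \<tau> * P (\<xi> + s * \<tau> + h)) integrable_on {0..}" for \<xi> h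
    using Pi[of "\<xi> + h"] by (simp add: ac_simps)
  have Wi: "(\<lambda>\<tau>. \<Gamma> \<tau> * W h (\<xi> + s * \<tau>)) integrable_on {0..}" for h \<xi>
    using integrable_diff[OF Pi' Qi] by (simp add: W_def right_diff_distrib)
  have Wdelay: "delayed_diff \<Gamma> s (W h) \<xi> = delayed_diff \<Gamma> s P (\<xi> + h) - delayed_diff \<Gamma> s Q \<xi>" for h \<xi>
    using integral_diff[OF Pi'[of \<xi> h] Qi[of \<xi>]]
    by (simp add: delayed_diff_eq[OF Wi] delayed_diff_eq[OF Pi] delayed_diff_eq[OF Qi])
       (simp add: W_def right_diff_distrib ac_simps)
  have ineq: "D * (P'' (\<xi> + h) - Q'' \<xi>) + c * (P' (\<xi> + h) - Q' \<xi>) + (f (P (\<xi> + h)) - f (Q \<xi>))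
      + \<gamma> * delayed_diff \<Gamma> s (W h) \<xi> \<le> 0" for h \<xi>
    using super[of "\<xi> + h"] sub[of \<xi>] unfolding residual_def Wdelay
    by (simp add: algebra_simps)
  obtain \<delta> where \<delta>: "\<delta> > 0"
    "\<And>u v. \<lbrakk>l \<le> u; u < v; v \<le> l + \<delta>\<rbrakk> \<Longrightarrow> f v < f u"
    "\<And>u v. \<lbrakk>r - \<delta> \<le> u; u < v; v \<le> r\<rbrakk> \<Longrightarrow> f v < f u"
    using f_decreasing_near_zeros by blast
  have "\<forall>\<^sub>F \<xi> in at_top. P \<xi> > r - \<delta>" using order_tendstoD(1)[OF Ptop] \<delta>(1) by simp
  then obtain R1 where R1: "\<And>\<xi>. \<xi> \<ge> R1 \<Longrightarrow> P \<xi> > r - \<delta>" by (auto simp: eventually_at_top_linorder)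
  have "\<forall>\<^sub>F \<xi> in at_bot. Q \<xi> < l + \<delta>" using order_tendstoD(2)[OF Qbot] \<delta>(1) by simp
  then obtain R2 where R2: "\<And>\<xi>. \<xi> \<le> R2 \<Longrightarrow> Q \<xi> < l + \<delta>" by (auto simp: eventually_at_bot_linorder)
  define R where "R = \<bar>R1\<bar> + \<bar>R2\<bar>"
  have R: "P \<xi> > r - \<delta>" if "\<xi> \<ge> R" for \<xi> using that R1 unfolding R_def by auto
  have R': "Q \<xi> < l + \<delta>" if "\<xi> \<le> - R" for \<xi> using that R2 unfolding R_def by auto
  \<comment> \<open>Negative values of \<open>W h\<close> anywhere force negative values in the bounded region \<open>- R < \<xi> < R - h\<close>.\<close>
  have tails: "0 \<le> W h \<xi>" if inner: "\<And>\<xi>. \<lbrakk>- R < \<xi>; \<xi> < R - h\<rbrakk> \<Longrightarrow> 0 \<le> W h \<xi>" for h \<xi>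
  proof (rule ccontr)
    assume neg: "\<not> 0 \<le> W h \<xi>"
    then obtain x0 where min: "\<And>x. W h x0 \<le> W h x"
      using global_min_below_limits[OF Wcont Wbot Wtop, of h \<xi>] by auto
    then have neg0: "W h x0 < 0" using neg by (meson leI order_trans)
    then have less: "P (x0 + h) < Q x0" unfolding W_def by simp
    have "P'' (x0 + h) - Q'' x0 \<ge> 0" "P' (x0 + h) - Q' x0 = 0"
      using derivatives_at_min[OF Wd Wd' min] by auto
    moreover have "0 \<le> delayed_diff \<Gamma> s (W h) x0" by (rule delayed_diff_nonneg[OF Wi]) (rule min)
    moreover have "0 \<le> D * (P'' (x0 + h) - Q'' x0)" "0 \<le> \<gamma> * delayed_diff \<Gamma> s (W h) x0"
      using calculation D_pos \<gamma>_nonneg by auto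
    ultimately have "f (P (x0 + h)) \<le> f (Q x0)" using ineq[of x0 h] by simp
    moreover have "f (Q x0) < f (P (x0 + h))"
    proof (cases "x0 \<le> - R")
      case True
      then show ?thesis using less P_ge R'[OF True] by (intro \<delta>(2)) auto
    next
      case False
      then have "R \<le> x0 + h" using inner[of x0] neg0 by force
      then show ?thesis using less Q_le R by (intro \<delta>(3)) (auto intro: less_imp_le)
    qed
    ultimately show False by simp
  qed
  obtain K where K: "K \<ge> 0" "\<And>u v. \<lbrakk>l \<le> u; u \<le> v; v \<le> r\<rbrakk> \<Longrightarrow> - K * (v - u) \<le> f v - f u"
    using f_one_sided_lipschitz by blast
  \<comment> \<open>The delayed difference of \<open>W h\<close> is at least \<open>- W h\<close>, which leaves a local differential inequality.\<close>
  have touch: "W h \<xi> = 0" if nonneg: "\<And>\<xi>. 0 \<le> W h \<xi>" and zero: "W h x0 = 0" for h x0 \<xi>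
  proof (rule strong_minimum_principle[OF D_pos _ Wd Wd' nonneg _ zero])
    show "0 \<le> K + \<gamma>" using K(1) \<gamma>_nonneg by simp
    fix x
    have "- K * W h x \<le> f (P (x + h)) - f (Q x)"
      using K(2)[of "Q x" "P (x + h)"] Q_ge P_le nonneg[of x] unfolding W_def by simp
    moreover have "0 \<le> integral {0..} (\<lambda>\<tau>. \<Gamma> \<tau> * W h (x + s * \<tau>))"
      by (rule integral_nonneg[OF Wi]) (use nonneg \<Gamma>_nonneg in simp)
    then have "\<gamma> * (- W h x) \<le> \<gamma> * delayed_diff \<Gamma> s (W h) x"
      unfolding delayed_diff_eq[OF Wi] using \<gamma>_nonneg by (intro mult_left_mono) auto
    ultimately show "D * (P'' (x + h) - Q'' x) + c * (P' (x + h) - Q' x) \<le> (K + \<gamma>) * W h x"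
      using ineq[of x h] by (simp add: algebra_simps)
  qed
  define S where "S = {h. \<forall>h'\<ge>h. \<forall>\<xi>. 0 \<le> W h' \<xi>}"
  have "0 \<le> W h \<xi>" if "2 * R \<le> h" for h \<xi> by (rule tails) (use that in linarith)
  then have "2 * R \<in> S" unfolding S_def by auto
  have "\<forall>\<^sub>F \<xi> in at_top. Q \<xi> > l" using order_tendstoD(1)[OF Qtop l_less_r] .
  then obtain x1 where x1: "Q x1 > l" by (auto simp: eventually_at_top_linorder)
  have "\<forall>\<^sub>F \<xi> in at_bot. P \<xi> < Q x1" using order_tendstoD(2)[OF Pbot x1] .
  then obtain N where N: "\<And>\<xi>. \<xi> \<le> N \<Longrightarrow> P \<xi> < Q x1" by (auto simp: eventually_at_bot_linorder)
  \<comment> \<open>Far to the right the translate of \<open>P\<close> falls below \<open>Q\<close> at \<open>x1\<close>, so admissible shifts are bounded below.\<close>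
  have lower: "N - x1 \<le> h" if "h \<in> S" for h
  proof (rule ccontr)
    assume "\<not> N - x1 \<le> h"
    then have "W h x1 < 0" using N[of "x1 + h"] unfolding W_def by simp
    moreover have "0 \<le> W h x1" using that unfolding S_def by auto
    ultimately show False by simp
  qed
  then have bdd: "bdd_below S" by (rule bdd_belowI)
  define h0 where "h0 = Inf S"
  have above: "0 \<le> W h \<xi>" if h: "h > h0" for h \<xi>
  proof -
    have "S \<noteq> {}" using \<open>2 * R \<in> S\<close> by (rule ex_in_conv[THEN iffD1, OF exI])
    then obtain h' where h': "h' \<in> S" "h' < h"
      using cInf_lessD[OF _ h[unfolded h0_def]] by metis
    have "\<forall>k\<ge>h'. \<forall>\<xi>. 0 \<le> W k \<xi>" using h'(1) unfolding S_def by (rule CollectD)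
    then show ?thesis using h'(2) less_imp_le by metis
  qed
  have at_h0: "0 \<le> W h0 \<xi>" for \<xi>
  proof -
    have "(\<lambda>n. \<xi> + (h0 + inverse (real (Suc n)))) \<longlonglongrightarrow> \<xi> + h0"
      by (intro tendsto_add tendsto_const LIMSEQ_inverse_real_of_nat_add)
    then have "(\<lambda>n. P (\<xi> + (h0 + inverse (real (Suc n))))) \<longlonglongrightarrow> P (\<xi> + h0)"
      by (rule isCont_tendsto_compose[OF DERIV_isCont[OF Pd(1)]])
    then have "(\<lambda>n. W (h0 + inverse (real (Suc n))) \<xi>) \<longlonglongrightarrow> W h0 \<xi>"
      unfolding W_def by (intro tendsto_diff tendsto_const)
    then show ?thesis by (rule LIMSEQ_le_const) (intro exI[of _ 0] allI impI above, simp)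
  qed
  have "\<exists>x0. W h0 x0 = 0"
  proof (rule ccontr)
    assume "\<nexists>x0. W h0 x0 = 0"
    then have pos: "0 < W h0 \<xi>" for \<xi> using at_h0[of \<xi>] by (metis less_eq_real_def)
    define R3 where "R3 = R + \<bar>h0\<bar> + 1"
    have R3: "0 \<le> R3" unfolding R3_def R_def by simp
    have "\<exists>x\<in>{- R3..R3}. \<forall>y\<in>{- R3..R3}. W h0 x \<le> W h0 y"
      by (rule continuous_attains_inf[OF _ _ Wcont]) (use R3 in auto)
    then obtain y0 where y0: "\<And>\<xi>. \<xi> \<in> {- R3..R3} \<Longrightarrow> W h0 y0 \<le> W h0 \<xi>" by blast
    have "uniformly_continuous_on {- R3 - \<bar>h0\<bar> - 1..R3 + \<bar>h0\<bar> + 1} P"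
      by (rule compact_uniformly_continuous[OF Pcont]) simp
    then obtain d where d: "d > 0"
      "\<forall>x\<in>{- R3 - \<bar>h0\<bar> - 1..R3 + \<bar>h0\<bar> + 1}. \<forall>y\<in>{- R3 - \<bar>h0\<bar> - 1..R3 + \<bar>h0\<bar> + 1}.
        dist y x < d \<longrightarrow> dist (P y) (P x) < W h0 y0"
      unfolding uniformly_continuous_on_def using pos[of y0] by blast
    define h1 where "h1 = h0 - min d 1 / 2"
    have h1: "h1 < h0" "h0 - h1 < d" "h0 - h1 \<le> 1" using d(1) unfolding h1_def by auto
    have "0 \<le> W h \<xi>" if "h1 \<le> h" for h \<xi>
    proof (cases "h0 < h")
      case False
      show ?thesis
      proof (rule tails)
        fix x assume x: "- R < x" "x < R - h"
        have xin: "x \<in> {- R3..R3}" using x h1 that unfolding R3_def by auto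
        have "dist (P (x + h)) (P (x + h0)) < W h0 y0"
          using xin h1 that False by (intro d(2)[rule_format]) (auto simp: dist_real_def abs_if)
        then show "0 \<le> W h x" using y0[OF xin] unfolding W_def dist_real_def by linarith
      qed
    qed (rule above)
    then have "h1 \<in> S" unfolding S_def by auto
    then have "h0 \<le> h1" unfolding h0_def by (rule cInf_lower[OF _ bdd])
    then show False using h1(1) by simp
  qed
  then obtain x0 where "W h0 x0 = 0" by blast
  then have "W h0 \<xi> = 0" for \<xi> by (rule touch[OF at_h0])
  then have "P (\<xi> + h0) = Q \<xi>" for \<xi> unfolding W_def by (metis eq_iff_diff_eq_0)
  moreover have "Q \<xi> \<le> P (\<xi> + h)" if "h0 \<le> h" for h \<xi>
    using above[of h \<xi>] at_h0[of \<xi>] that unfolding W_def by (cases "h = h0") auto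
  ultimately show ?thesis using that by blast
qed

text \<open>
  Sliding a front over itself ends at a shift that is a period of the front. Different limits allow
  only the period zero, and so every positive shift moves the front upwards.
\<close>

lemma front_monotone:
  assumes "front_profile D f \<gamma> \<Gamma> s l r c U U' U''"
  shows "mono U" "0 \<le> U' \<xi>"
proof -
  have U: "front_shape \<Gamma> s l r U U' U''" and res: "residual D f \<gamma> \<Gamma> s c U U' U'' \<xi> = 0" for \<xi>
    using assms unfolding front_profile_def by auto
  have d: "\<And>\<xi>. (U has_real_derivative U' \<xi>) (at \<xi>)"
    and lim: "(U \<longlongrightarrow> l) at_bot" "(U \<longlongrightarrow> r) at_top"
    using U unfolding front_shape_def by auto
  have super: "residual D f \<gamma> \<Gamma> s c U U' U'' \<xi> \<le> 0" and sub: "0 \<le> residual D f \<gamma> \<Gamma> s c U U' U'' \<xi>" for \<xi>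
    using res by simp_all
  obtain h0 where h0: "\<And>\<xi>. U (\<xi> + h0) = U \<xi>" "\<And>h \<xi>. h0 \<le> h \<Longrightarrow> U \<xi> \<le> U (\<xi> + h)"
    by (rule sliding[OF U U super sub front_le_r[OF U sub] front_ge_l[OF U super]]) (rule that)
  have "h0 = 0" using no_period_if_limits_differ[OF lim _ h0(1)] l_less_r by simp
  show mono: "mono U"
  proof (rule monoI)
    show "U x \<le> U y" if "x \<le> y" for x y
      using h0(2)[of "y - x" x] that \<open>h0 = 0\<close> by simp
  qed
  show "0 \<le> U' \<xi>" by (rule mono_on_imp_deriv_nonneg[OF mono d]) simp
qed

section \<open>Speed estimates\<close>

text \<open>
  If \<open>c < 0\<close>, monotonicity makes the delayed difference nonpositive, and the energy \<open>E\<close> grows at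
  rate at least \<open>- c U'\<^sup>2\<close>. Its limits along the sequences with vanishing slope differ by the
  integral of \<open>f\<close>; if this is not positive, \<open>E\<close> is constant and hence so is \<open>U\<close>.
\<close>

lemma speed_nonneg_if_integral_nonpos:
  assumes U: "front_profile D f \<gamma> \<Gamma> c l r c U U' U''" and int: "integral {l..r} f \<le> 0"
  shows "0 \<le> c"
proof (rule ccontr)
  assume "\<not> 0 \<le> c"
  then have c: "c < 0" by simp
  have shape: "front_shape \<Gamma> c l r U U' U''" and res: "residual D f \<gamma> \<Gamma> c c U U' U'' \<xi> = 0" for \<xi>
    using U unfolding front_profile_def by auto
  have d: "\<And>\<xi>. (U has_real_derivative U' \<xi>) (at \<xi>)" "\<And>\<xi>. (U' has_real_derivative U'' \<xi>) (at \<xi>)"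
    and i: "\<And>\<xi>. (\<lambda>\<tau>. \<Gamma> \<tau> * U (\<xi> + c * \<tau>)) integrable_on {0..}"
    and lim: "(U \<longlongrightarrow> l) at_bot" "(U \<longlongrightarrow> r) at_top"
    using shape unfolding front_shape_def by auto
  have mono: "mono U" and U': "\<And>\<xi>. 0 \<le> U' \<xi>" using front_monotone[OF U] by auto
  have range: "l \<le> U \<xi>" "U \<xi> \<le> r" for \<xi>
    by (rule front_ge_l[OF shape, of c], simp add: res) (rule front_le_r[OF shape, of c], simp add: res)
  \<comment> \<open>Starting the primitive at \<open>l - 1\<close> makes it differentiable from both sides at \<open>l\<close>.\<close>
  define \<Phi> where "\<Phi> u = integral {l - 1..u} f" for u
  have \<Phi>d: "(\<Phi> has_real_derivative f u) (at u)" if "l \<le> u" "u \<le> r" for u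
  proof -
    have "(\<Phi> has_real_derivative f u) (at u within {l - 1..r + 1})"
      unfolding \<Phi>_def by (rule integral_has_real_derivative[OF f_cont]) (use that in auto)
    then show ?thesis using that at_within_Icc_at[of "l - 1" u "r + 1"] by simp
  qed
  have "(f has_integral \<Phi> r - \<Phi> l) {l..r}"
    using l_less_r \<Phi>d
    by (intro fundamental_theorem_of_calculus)
       (auto simp: has_real_derivative_iff_has_vector_derivative[symmetric] intro: has_field_derivative_at_within)
  then have \<Phi>lr: "\<Phi> r \<le> \<Phi> l" using int by (simp add: integral_unique)
  define E where "E \<xi> = D * (U' \<xi>)\<^sup>2 / 2 + \<Phi> (U \<xi>)" for \<xi>
  have Ed: "(E has_real_derivative U' \<xi> * (D * U'' \<xi> + f (U \<xi>))) (at \<xi>)" for \<xi>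
    unfolding E_def
    by (auto intro!: derivative_eq_intros DERIV_chain2[OF \<Phi>d] d range simp: algebra_simps)
  have growth: "- c * (U' \<xi>)\<^sup>2 \<le> U' \<xi> * (D * U'' \<xi> + f (U \<xi>))" for \<xi>
  proof -
    have "delayed_diff \<Gamma> c U \<xi> \<le> 0"
      by (rule delayed_diff_nonpos[OF i]) (use c in \<open>auto intro!: monoD[OF mono] mult_nonpos_nonneg\<close>)
    then have "\<gamma> * delayed_diff \<Gamma> c U \<xi> \<le> 0" using \<gamma>_nonneg by (rule mult_nonneg_nonpos[rotated])
    then have "- c * U' \<xi> \<le> D * U'' \<xi> + f (U \<xi>)" using res[of \<xi>] unfolding residual_def by simp
    then have "U' \<xi> * (- c * U' \<xi>) \<le> U' \<xi> * (D * U'' \<xi> + f (U \<xi>))" using U' by (rule mult_left_mono)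
    then show ?thesis by (simp add: power2_eq_square algebra_simps)
  qed
  have growth0: "0 \<le> U' \<xi> * (D * U'' \<xi> + f (U \<xi>))" for \<xi>
    by (rule order_trans[OF _ growth]) (use c in \<open>simp add: mult_nonpos_nonneg\<close>)
  have Emono: "mono E"
    by (rule monoI, rule DERIV_nonneg_imp_nondecreasing) (use Ed growth0 in auto)
  obtain y z :: "nat \<Rightarrow> real" where y: "filterlim y at_bot sequentially" "(\<lambda>n. U' (y n)) \<longlonglongrightarrow> 0"
    and z: "filterlim z at_top sequentially" "(\<lambda>n. U' (z n)) \<longlonglongrightarrow> 0"
    using derivative_vanishes_along_sequences[OF d(1) lim] by blast
  have Elim: "(\<lambda>n. E (w n)) \<longlonglongrightarrow> D * 0\<^sup>2 / 2 + \<Phi> a"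
    if "(\<lambda>n. U' (w n)) \<longlonglongrightarrow> 0" "(\<lambda>n. U (w n)) \<longlonglongrightarrow> a" "l \<le> a" "a \<le> r" for w :: "nat \<Rightarrow> real" and a
    unfolding E_def using that
    by (intro tendsto_intros isCont_tendsto_compose[OF DERIV_isCont[OF \<Phi>d]]) auto
  have "E \<xi> = \<Phi> l" for \<xi>
  proof -
    have "\<Phi> l \<le> E \<xi>" "E \<xi> \<le> \<Phi> r"
      using mono_between_sequential_limits[OF Emono y(1) Elim[OF y(2) filterlim_compose[OF lim(1) y(1)]]
          z(1) Elim[OF z(2) filterlim_compose[OF lim(2) z(1)]], of \<xi>] l_less_r by auto
    then show ?thesis using \<Phi>lr by simp
  qed
  then have "E = (\<lambda>_. \<Phi> l)" by blast
  then have balance: "U' \<xi> * (D * U'' \<xi> + f (U \<xi>)) = 0" for \<xi>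
    using DERIV_unique[OF Ed[of \<xi>], of 0] by simp
  have "U' \<xi> = 0" for \<xi> 
  proof -
    have "- c * (U' \<xi>)\<^sup>2 \<le> 0" using growth[of \<xi>] by (simp only: balance)
    then show ?thesis using c by (simp add: zero_le_mult_iff)
  qed
  then have "U \<xi> = U (\<xi> + 1)" for \<xi> using DERIV_isconst_all[of U \<xi> "\<xi> + 1"] d(1) by simp
  then show False using no_period_if_limits_differ[OF lim, of 1] l_less_r by simp
qed

text \<open>
  If \<open>C < c\<close>, the memory front is a supersolution of the local equation with speed \<open>C\<close>: its delayed
  differences are nonnegative and \<open>(c - C) U'\<close> adds a further nonnegative excess. Sliding it onto
  the local front makes it a solution, so that the excess vanishes and \<open>U\<close> is constant.
\<close>

lemma speed_le_local_speed:
  assumes U: "front_profile D f \<gamma> \<Gamma> c l r c U U' U''" and c: "0 \<le> c"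
    and V: "front_profile D f \<gamma> \<Gamma> 0 l r C V V' V''"
  shows "c \<le> C"
proof (rule ccontr)
  assume "\<not> c \<le> C"
  then have cC: "c - C > 0" by simp
  have shape: "front_shape \<Gamma> c l r U U' U''" and res: "residual D f \<gamma> \<Gamma> c c U U' U'' \<xi> = 0" for \<xi>
    using U unfolding front_profile_def by auto
  have Vshape: "front_shape \<Gamma> 0 l r V V' V''" and Vres: "residual D f \<gamma> \<Gamma> 0 C V V' V'' \<xi> = 0" for \<xi>
    using V unfolding front_profile_def by auto
  have mono: "mono U" and U': "\<And>\<xi>. 0 \<le> U' \<xi>" using front_monotone[OF U] by auto
  have d: "\<And>\<xi>. (U has_real_derivative U' \<xi>) (at \<xi>)" "\<And>\<xi>. (U' has_real_derivative U'' \<xi>) (at \<xi>)"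
    and i: "\<And>\<xi>. (\<lambda>\<tau>. \<Gamma> \<tau> * U (\<xi> + c * \<tau>)) integrable_on {0..}"
    and lim: "(U \<longlongrightarrow> l) at_bot" "(U \<longlongrightarrow> r) at_top"
    using shape unfolding front_shape_def by auto
  have Vd: "\<And>\<xi>. (V has_real_derivative V' \<xi>) (at \<xi>)" "\<And>\<xi>. (V' has_real_derivative V'' \<xi>) (at \<xi>)"
    using Vshape unfolding front_shape_def by auto
  have local_shape: "front_shape \<Gamma> 0 l r U U' U''"
    using shape \<Gamma>_const_integrable unfolding front_shape_def by simp
  have excess: "residual D f \<gamma> \<Gamma> 0 C U U' U'' \<xi> \<le> - (c - C) * U' \<xi>" for \<xi>
  proof -
    have "0 \<le> delayed_diff \<Gamma> c U \<xi>"
      by (rule delayed_diff_nonneg[OF i]) (use c in \<open>auto intro!: monoD[OF mono]\<close>)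
    then have "0 \<le> \<gamma> * delayed_diff \<Gamma> c U \<xi>" using \<gamma>_nonneg by simp
    then show ?thesis using res[of \<xi>] unfolding residual_def by (simp add: algebra_simps)
  qed
  have super: "residual D f \<gamma> \<Gamma> 0 C U U' U'' \<xi> \<le> 0" for \<xi>
    using excess[of \<xi>] mult_nonneg_nonneg[of "c - C" "U' \<xi>"] cC U'[of \<xi>] by linarith
  have U_le: "U \<xi> \<le> r" and V_ge: "l \<le> V \<xi>" and sub: "0 \<le> residual D f \<gamma> \<Gamma> 0 C V V' V'' \<xi>" for \<xi>
    using front_le_r[OF shape, of c] front_ge_l[OF Vshape, of C] res Vres by auto
  obtain h0 where h0: "\<And>\<xi>. U (\<xi> + h0) = V \<xi>"
    by (rule sliding[OF local_shape Vshape super sub U_le V_ge]) (rule that)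
  have "V = (\<lambda>\<xi>. U (\<xi> + h0))" using h0 by auto
  then have V'_eq: "V' \<xi> = U' (\<xi> + h0)" for \<xi>
    using Vd(1)[of \<xi>] d(1)[of "\<xi> + h0", unfolded DERIV_shift] DERIV_unique by blast
  then have "V' = (\<lambda>\<xi>. U' (\<xi> + h0))" by auto
  then have V''_eq: "V'' \<xi> = U'' (\<xi> + h0)" for \<xi>
    using Vd(2)[of \<xi>] d(2)[of "\<xi> + h0", unfolded DERIV_shift] DERIV_unique by blast
  have "residual D f \<gamma> \<Gamma> 0 C U U' U'' (\<xi> + h0) = 0" for \<xi>
    using Vres[of \<xi>] unfolding residual_def by (simp add: h0 V'_eq V''_eq)
  then have residual_zero: "residual D f \<gamma> \<Gamma> 0 C U U' U'' \<xi> = 0" for \<xi>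
    by (metis diff_add_cancel)
  have "U' \<xi> = 0" for \<xi>
  proof (rule antisym[OF _ U'])
    have "(c - C) * U' \<xi> \<le> 0" using excess[of \<xi>] residual_zero[of \<xi>] by linarith
    then show "U' \<xi> \<le> 0" using cC by (simp add: mult_le_0_iff)
  qed
  then have "U \<xi> = U (\<xi> + 1)" for \<xi> using DERIV_isconst_all[of U \<xi> "\<xi> + 1"] d(1) by simp
  then show False using no_period_if_limits_differ[OF lim, of 1] l_less_r by simp
qed

text \<open>
  The slope of the front at height \<open>m\<close> is bounded from below by integrating the equation ahead of
  this point and from above by a Gronwall estimate behind it.
\<close>

lemma local_speed_le:
  assumes V: "front_profile D f \<gamma> \<Gamma> 0 l r C V V' V''"
    and \<Phi>: "\<And>u. u \<in> {l..m} \<Longrightarrow> - \<Phi> \<le> f u"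
  shows "C \<le> sqrt (\<Phi> * D / (r - m))"
proof (cases "C > 0")
  case False
  have "0 \<le> \<Phi>" using \<Phi>[of l] lm f_zero_iff[of l] by simp
  then have "0 \<le> sqrt (\<Phi> * D / (r - m))" using D_pos mr by simp
  then show ?thesis using False by linarith
next
  case C: True
  have shape: "front_shape \<Gamma> 0 l r V V' V''" and "\<And>\<xi>. residual D f \<gamma> \<Gamma> 0 C V V' V'' \<xi> = 0"
    using V unfolding front_profile_def by auto
  then have ode: "D * V'' \<xi> + C * V' \<xi> + f (V \<xi>) = 0" for \<xi> unfolding residual_def by simp
  have d: "\<And>\<xi>. (V has_real_derivative V' \<xi>) (at \<xi>)" "\<And>\<xi>. (V' has_real_derivative V'' \<xi>) (at \<xi>)"
    and lim: "(V \<longlongrightarrow> l) at_bot" "(V \<longlongrightarrow> r) at_top"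
    using shape unfolding front_shape_def by auto
  have mono: "mono V" by (rule front_monotone(1)[OF V])
  have range: "l \<le> V \<xi>" "V \<xi> \<le> r" for \<xi>
    using front_ge_l[OF shape, of C] front_le_r[OF shape, of C] V unfolding front_profile_def by auto
  obtain y z :: "nat \<Rightarrow> real" where y: "filterlim y at_bot sequentially" "(\<lambda>n. V' (y n)) \<longlonglongrightarrow> 0"
    and z: "filterlim z at_top sequentially" "(\<lambda>n. V' (z n)) \<longlonglongrightarrow> 0"
    using derivative_vanishes_along_sequences[OF d(1) lim] by blast
  have "\<forall>\<^sub>F \<xi> in at_bot. V \<xi> < m" using order_tendstoD(2)[OF lim(1) lm] .
  then obtain a where a: "V a < m" by (auto simp: eventually_at_bot_linorder)
  have "\<forall>\<^sub>F \<xi> in at_top. m < V \<xi>" using order_tendstoD(1)[OF lim(2) mr] .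
  then obtain b where b: "m < V b" by (auto simp: eventually_at_top_linorder)
  have "a \<le> b" using monoD[OF mono, of b a] a b by force
  then obtain x0 where x0: "V x0 = m"
    using IVT[of V a m b] a b d(1) DERIV_isCont by (metis less_imp_le)
  have "C * r \<le> D * V' x0 + C * m"
  proof -
    define G where "G \<xi> = D * V' \<xi> + C * V \<xi>" for \<xi>
    have Gd: "(G has_real_derivative D * V'' \<xi> + C * V' \<xi>) (at \<xi>)" for \<xi>
      unfolding G_def by (auto intro!: derivative_eq_intros d)
    have "D * V'' \<xi> + C * V' \<xi> \<le> 0" if "x0 \<le> \<xi>" for \<xi>
    proof -
      have "m \<le> V \<xi>" using monoD[OF mono that] x0 by simp
      then have "0 \<le> f (V \<xi>)"
        using f_pos_upper[of "V \<xi>"] f_zero_iff[of "V \<xi>"] range(2)[of \<xi>] by fastforce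
      then show ?thesis using ode[of \<xi>] by simp
    qed
    then have "G \<xi> \<le> G x0" if "x0 \<le> \<xi>" for \<xi>
      by - (rule DERIV_nonpos_imp_nonincreasing[OF that], use Gd in blast)
    moreover have "\<forall>\<^sub>F n in sequentially. x0 \<le> z n" using z(1) unfolding filterlim_at_top by blast
    ultimately have "\<forall>\<^sub>F n in sequentially. G (z n) \<le> G x0" by (auto elim: eventually_mono)
    moreover have "(\<lambda>n. G (z n)) \<longlonglongrightarrow> D * 0 + C * r"
      unfolding G_def by (intro tendsto_intros z(2) filterlim_compose[OF lim(2) z(1)])
    ultimately have "D * 0 + C * r \<le> G x0" by (intro tendsto_upperbound) auto
    then show ?thesis unfolding G_def x0 by simp
  qed
  moreover have "C * V' x0 \<le> \<Phi>"
  proof -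
    define H where "H \<xi> = exp (C * \<xi> / D) * (C * V' \<xi> - \<Phi>)" for \<xi>
    have Hd: "(H has_real_derivative exp (C * \<xi> / D) * (C / D * (C * V' \<xi> - \<Phi> + D * V'' \<xi>))) (at \<xi>)" for \<xi>
      unfolding H_def using D_pos by (auto intro!: derivative_eq_intros d simp: field_simps)
    have "C / D * (C * V' \<xi> - \<Phi> + D * V'' \<xi>) \<le> 0" if "\<xi> \<le> x0" for \<xi>
    proof -
      have "V \<xi> \<le> m" using monoD[OF mono that] x0 by simp
      then have "C * V' \<xi> - \<Phi> + D * V'' \<xi> \<le> 0" using \<Phi>[of "V \<xi>"] range(1)[of \<xi>] ode[of \<xi>] by simp
      then show ?thesis using C D_pos by (intro mult_nonneg_nonpos) auto
    qed
    then have "\<exists>d. (H has_real_derivative d) (at \<xi>) \<and> d \<le> 0" if "\<xi> \<le> x0" for \<xi>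
      using Hd[of \<xi>] that by (meson exp_ge_zero mult_nonneg_nonpos)
    then have Hmono: "H x0 \<le> H \<xi>" if "\<xi> \<le> x0" for \<xi>
      by - (rule DERIV_nonpos_imp_nonincreasing[OF that], simp)
    have "\<forall>\<^sub>F n in sequentially. y n \<le> x0" using y(1) unfolding filterlim_at_bot by blast
    then have "\<forall>\<^sub>F n in sequentially. H x0 \<le> H (y n)" by (auto elim: eventually_mono intro: Hmono)
    moreover have "filterlim (\<lambda>n. C / D * y n) at_bot sequentially"
      using C D_pos by (intro filterlim_tendsto_pos_mult_at_bot[OF tendsto_const _ y(1)]) simp
    then have "(\<lambda>n. exp (C * y n / D)) \<longlonglongrightarrow> 0" using filterlim_compose[OF exp_at_bot] by fastforce
    then have "(\<lambda>n. H (y n)) \<longlonglongrightarrow> 0 * (C * 0 - \<Phi>)"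
      unfolding H_def by (intro tendsto_intros y(2))
    ultimately have "H x0 \<le> 0 * (C * 0 - \<Phi>)" by (intro tendsto_lowerbound) auto
    then show ?thesis unfolding H_def by (simp add: mult_le_0_iff)
  qed
  ultimately have "C * (C * (r - m)) \<le> \<Phi> * D"
  proof -
    assume "C * r \<le> D * V' x0 + C * m" and upper: "C * V' x0 \<le> \<Phi>"
    then have "C * (C * (r - m)) \<le> C * (D * V' x0)"
      using C by (intro mult_left_mono) (auto simp: algebra_simps)
    also have "\<dots> = (C * V' x0) * D" by simp
    also have "\<dots> \<le> \<Phi> * D" using upper D_pos by (intro mult_right_mono) auto
    finally show ?thesis .
  qed
  then have "C\<^sup>2 \<le> \<Phi> * D / (r - m)" using mr by (simp add: power2_eq_square field_simps)
  then show ?thesis by (rule real_le_rsqrt)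
qed

section \<open>Both signs of the integral, and fronts of the evolution equations\<close>

lemma speed_bounds:
  assumes U: "front_profile D f \<gamma> \<Gamma> c l r c U U' U''"
    and V: "front_profile D f \<gamma> \<Gamma> 0 l r C V V' V''"
    and \<Phi>: "\<And>u. u \<in> {l..m} \<Longrightarrow> - \<Phi> \<le> f u"
    and int: "integral {l..r} f \<le> 0"
  shows "0 \<le> c \<and> c \<le> C \<and> C \<le> sqrt (\<Phi> * D / (r - m))"
  using speed_nonneg_if_integral_nonpos[OF U int] speed_le_local_speed[OF U _ V] local_speed_le[OF V \<Phi>]
  by blast


lemma reflected_speed_bounds:
  assumes U: "front_profile D f \<gamma> \<Gamma> c l r c U U' U''"
    and V: "front_profile D f \<gamma> \<Gamma> 0 l r C V V' V''"
    and \<Phi>: "\<And>u. u \<in> {m..r} \<Longrightarrow> f u \<le> \<Phi>"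
    and int: "0 \<le> integral {l..r} f"
  shows "0 \<ge> c \<and> c \<ge> C \<and> C \<ge> - sqrt (\<Phi> * D / (m - l))"
proof -
  interpret R: bistable_delay D \<gamma> \<Gamma> "\<lambda>u. - f (- u)" "\<lambda>u. f' (- u)" "- r" "- m" "- l"
    by (rule reflected)
  have "integral {- r..- l} (\<lambda>u. - f (- u)) = - integral {l..r} f"
    by (simp add: integral_reflect_real)
  then have "0 \<le> - c \<and> - c \<le> - C \<and> - C \<le> sqrt (\<Phi> * D / (- l - - m))"
    using front_profile_reflect[OF U] front_profile_reflect[OF V] int
    by (intro R.speed_bounds) (auto intro!: \<Phi>)
  then show ?thesis by (simp add: algebra_simps)
qed

text \<open>
  For a travelling wave the equation at time \<open>0\<close> already contains the whole profile equation;
  writing \<open>F u = f u - \<gamma> u\<close> turns the memory integral into a delayed difference.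
\<close>

lemma front_profile_of_rd_solution:
  assumes f: "\<And>u. f u = F u + \<gamma> * u"
    and sol: "solves_rd D F w (\<lambda>t x. U (x - c * t))"
    and w: "\<And>\<xi>. w 0 \<xi> = \<gamma> * integral {0..} (\<lambda>\<tau>. \<Gamma> \<tau> * U (\<xi> + s * \<tau>))"
    and int: "\<And>\<xi>. (\<lambda>\<tau>. \<Gamma> \<tau> * U (\<xi> + s * \<tau>)) integrable_on {0..}"
    and lim: "(U \<longlongrightarrow> l) at_bot" "(U \<longlongrightarrow> r) at_top"
  obtains U' U'' where "front_profile D f \<gamma> \<Gamma> s l r c U U' U''"
proof -
  obtain ut ux uxx where sol:
    "\<And>t x. ((\<lambda>s. U (x - c * s)) has_real_derivative ut t x) (at t)"
    "\<And>t x. ((\<lambda>y. U (y - c * t)) has_real_derivative ux t x) (at x)"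
    "\<And>t x. ((\<lambda>y. ux t y) has_real_derivative uxx t x) (at x)"
    "\<And>t x. ut t x = D * uxx t x + F (U (x - c * t)) + w t x"
    using sol unfolding solves_rd_def by metis
  have d: "(U has_real_derivative ux 0 \<xi>) (at \<xi>)" for \<xi> using sol(2)[of 0 \<xi>] by simp
  have "((\<lambda>s. \<xi> - c * s) has_real_derivative - c) (at 0)" for \<xi>
    by (auto intro!: derivative_eq_intros)
  then have "((\<lambda>s. U (\<xi> - c * s)) has_real_derivative ux 0 \<xi> * - c) (at 0)" for \<xi>
    using DERIV_chain2[of U "ux 0 \<xi>" "\<lambda>s. \<xi> - c * s" 0 "- c"] d[of \<xi>] by simp
  then have "ut 0 \<xi> = - c * ux 0 \<xi>" for \<xi>
    using sol(1)[where t=0 and x=\<xi>] DERIV_unique by (metis mult.commute)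
  then have "residual D f \<gamma> \<Gamma> s c U (ux 0) (uxx 0) \<xi> = 0" for \<xi>
    using sol(4)[of 0 \<xi>] unfolding residual_def delayed_diff_eq[OF int] w f
    by (simp add: algebra_simps)
  then have "front_profile D f \<gamma> \<Gamma> s l r c U (ux 0) (uxx 0)"
    unfolding front_profile_def front_shape_def using d sol(3) int lim by simp
  then show ?thesis by (rule that)
qed

end

lemma bistable_delay_F_gam:
  assumes "D > 0" and B: "assumption_B F \<gamma>s um u0 up" and K: "assumption_K \<Gamma>"
    and \<gamma>: "\<gamma> \<in> {0..\<gamma>s}"
  obtains f' where "bistable_delay D \<gamma> \<Gamma> (F_gam F \<gamma>) f' (um \<gamma>) (u0 \<gamma>) (up \<gamma>)"
proof -
  obtain F' F'' where F': "\<And>x. (F has_real_derivative F' x) (at x)"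
    and F'': "\<And>x. (F' has_real_derivative F'' x) (at x)"
    using B unfolding assumption_B_def C2_def by metis
  have d: "(F_gam F \<gamma> has_real_derivative F' u + \<gamma>) (at u)" for u
    unfolding F_gam_def[abs_def] by (auto intro!: derivative_eq_intros F')
  then have deriv: "deriv (F_gam F \<gamma>) u = F' u + \<gamma>" for u by (rule DERIV_imp_deriv)
  have "continuous_on UNIV F'" by (meson DERIV_isCont F'' continuous_at_imp_continuous_on)
  have "bistable_delay D \<gamma> \<Gamma> (F_gam F \<gamma>) (\<lambda>u. F' u + \<gamma>) (um \<gamma>) (u0 \<gamma>) (up \<gamma>)"
  proof
    show "continuous_on UNIV (\<lambda>u. F' u + \<gamma>)"
      by (intro continuous_intros \<open>continuous_on UNIV F'\<close>)
    show "F' (um \<gamma>) + \<gamma> < 0" "F' (up \<gamma>) + \<gamma> < 0"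
      using B \<gamma> unfolding assumption_B_def deriv[symmetric] by auto
  qed (use assms d in \<open>auto simp: assumption_B_def assumption_K_def\<close>)
  then show ?thesis by (rule that)
qed

theorem corollary2p9:
  fixes D \<gamma>s \<gamma> \<Phi>_lo \<Phi>_up a_lo b_lo \<alpha>_lo a_up b_up \<alpha>_up c\<gamma> C\<gamma>0 :: real
    and F \<Gamma> um u0 up :: "real \<Rightarrow> real"
  assumes "D > 0"
    and "assumption_B F \<gamma>s um u0 up"
    and "assumption_K \<Gamma>"
    and "\<gamma> \<in> {0..\<gamma>s}"
    and "\<And>u. u \<in> {um \<gamma>..u0 \<gamma>} \<Longrightarrow> F_gam F \<gamma> u \<ge> - \<Phi>_lo"
    and "\<And>u. u \<in> {u0 \<gamma>..up \<gamma>} \<Longrightarrow> F_gam F \<gamma> u \<le> \<Phi>_up"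
    and "a_lo \<in> {u0 \<gamma>..up \<gamma>}" "b_lo \<in> {u0 \<gamma>..up \<gamma>}" "a_lo < b_lo" "\<alpha>_lo > 0"
    and "\<And>u. u \<in> {a_lo..b_lo} \<Longrightarrow> F_gam F \<gamma> u \<ge> \<alpha>_lo * (u - a_lo)"
    and "a_up \<in> {um \<gamma>..u0 \<gamma>}" "b_up \<in> {um \<gamma>..u0 \<gamma>}" "b_up < a_up" "\<alpha>_up > 0"
    and "\<And>u. u \<in> {b_up..a_up} \<Longrightarrow> F_gam F \<gamma> u \<le> \<alpha>_up * (u - a_up)"
    and "is_memory_front_speed D F \<Gamma> um up \<gamma> c\<gamma>"
    and "is_wave_speed D F \<Gamma> um up \<gamma> 0 C\<gamma>0"
  shows "(integral {um \<gamma>..up \<gamma>} (F_gam F \<gamma>) \<le> 0 \<longrightarrow>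
            0 \<le> c\<gamma> \<and> c\<gamma> \<le> C\<gamma>0 \<and> C\<gamma>0 \<le> sqrt (\<Phi>_lo * D / (up \<gamma> - u0 \<gamma>))) \<and>
         (integral {um \<gamma>..up \<gamma>} (F_gam F \<gamma>) \<ge> 0 \<longrightarrow>
            0 \<ge> c\<gamma> \<and> c\<gamma> \<ge> C\<gamma>0 \<and> C\<gamma>0 \<ge> - sqrt (\<Phi>_up * D / (u0 \<gamma> - um \<gamma>)))"
proof -
  obtain f' where "bistable_delay D \<gamma> \<Gamma> (F_gam F \<gamma>) f' (um \<gamma>) (u0 \<gamma>) (up \<gamma>)"
    using bistable_delay_F_gam[OF assms(1-4)] by blast
  then interpret bistable_delay D \<gamma> \<Gamma> "F_gam F \<gamma>" f' "um \<gamma>" "u0 \<gamma>" "up \<gamma>" .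
  obtain U where U:
    "\<And>\<xi>. (\<lambda>\<tau>. \<Gamma> \<tau> * U (\<xi> - c\<gamma> * (0 - \<tau>))) integrable_on {0..}"
    "solves_rd D F (\<lambda>t x. \<gamma> * integral {0..} (\<lambda>\<tau>. \<Gamma> \<tau> * U (x - c\<gamma> * (t - \<tau>)))) (\<lambda>t x. U (x - c\<gamma> * t))"
    "(U \<longlongrightarrow> um \<gamma>) at_bot" "(U \<longlongrightarrow> up \<gamma>) at_top"
    using assms(17) unfolding is_memory_front_speed_def traveling_front_def memory_equation_def by blast
  obtain U' U'' where front: "front_profile D (F_gam F \<gamma>) \<gamma> \<Gamma> c\<gamma> (um \<gamma>) (up \<gamma>) c\<gamma> U U' U''"
    by (rule front_profile_of_rd_solution[OF F_gam_def U(2) _ _ U(3,4), of c\<gamma>]) (use U(1) in simp_all)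
  obtain V where V:
    "solves_rd D F (\<lambda>t x. \<gamma> * integral {0..} (\<lambda>\<tau>. \<Gamma> \<tau> * V (x + 0 * \<tau> - C\<gamma>0 * t))) (\<lambda>t x. V (x - C\<gamma>0 * t))"
    "(V \<longlongrightarrow> um \<gamma>) at_bot" "(V \<longlongrightarrow> up \<gamma>) at_top"
    using assms(18) unfolding is_wave_speed_def traveling_front_def auxiliary_equation_def by blast
  obtain V' V'' where local_front: "front_profile D (F_gam F \<gamma>) \<gamma> \<Gamma> 0 (um \<gamma>) (up \<gamma>) C\<gamma>0 V V' V''"
    by (rule front_profile_of_rd_solution[OF F_gam_def V(1) _ _ V(2,3), of 0])
       (use \<Gamma>_const_integrable in simp_all)
  show ?thesis
    using speed_bounds[OF front local_front assms(5)] reflected_speed_bounds[OF front local_front assms(6)]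
    by blast
qed

end
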